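(* Let $\Sigma^{\mathrm{DNN}}=(\Sigma^{\mathrm{DNN}}_n)_{n\in\mathbb{N}}$ and $\Sigma^{\mathrm{CTT}}=(\Sigma^{\mathrm{CTT}}_n)_{n\in\mathbb{N}}$ be the approximation tools given by deep neural networks and by compositional tensor trains of fixed width $p_f\ge d$ with complexity measured by the number of parameters. Then there exists $c\ge1$ such that $\Sigma^{\mathrm{DNN}}_n\subseteq\Sigma^{\mathrm{CTT}}_{cn}$ for all $n$, and consequently $$A^\alpha_q(X,\Sigma^{\mathrm{DNN}})\hookrightarrow A^\alpha_q(X,\Sigma^{\mathrm{CTT}}),$$ i.e. $A^\alpha_q(X,\Sigma^{\mathrm{DNN}})$ is continuously embedded in $A^\alpha_q(X,\Sigma^{\mathrm{CTT}})$.
   Context: $X$ is a normed space of functions $\mathbb{R}^d\to\mathbb{R}^{d_o}$ (or on a subdomain) in which approximation is measured, $\alpha>0$ and $0<q\le\infty$. For an approximation tool $\Sigma=(\Sigma_n)_{n}$, $E(f,\Sigma_n)_X$ denotes the best approximation error $\inf_{g\in\Sigma_n\cap X}\|f-g\|_X$ (with $\Sigma_0=\{0\}$), $A^\alpha_q(X,\Sigma):=\{f\in X:\|f\|_{A^\alpha_q}<\infty\}$, with $\|f\|_{A^\alpha_q}:=\big[\sum_{n\ge1}(n^\alpha E(f,\Sigma_{n-1})_X)^q\frac1n\big]^{1/q}$ for $q<\infty$ and $\|f\|_{A^\alpha_\infty}:=\sup_{n\ge1}n^\alpha E(f,\Sigma_{n-1})_X$. The width $p_f\ge d,d_o$ is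 fixed, so the number of layers is the only free architectural parameter. $\sigma:\mathbb{R}\to\mathbb{R}$ is an activation function and $\Phi=\{\phi_1,\dots,\phi_m\}$ a finite set of functions $\mathbb{R}\to\mathbb{R}$ with $\{1,x\}\subseteq\Phi$ and $\sigma\in\operatorname{span}\Phi$. $\Sigma^{\mathrm{DNN}}_n$ is the set of functions $T_L\circ\sigma\circ T_{L-1}\circ\dots\circ\sigma\circ T_1$ ($\sigma$ componentwise, $T_1:\mathbb{R}^d\to\mathbb{R}^{p_f}$, $T_\ell:\mathbb{R}^{p_f}\to\mathbb{R}^{p_f}$ for $2\le\ell\le L-1$, $T_L:\mathbb{R}^{p_f}\to\mathbb{R}^{d_o}$ affine, $L\ge2$) whose total number of parameters (entries of the weight matrices and bias vectors) is at most $n$. $\Sigma^{\mathrm{CTT}}_n$ is the set of functions $\mathfrak{R}\circ(\mathrm{Id}+\psi_L)\circ\dots\circ(\mathrm{Id}+\psi_1)\circ\mathfrak{L}$ with $L\ge1$, $\mathfrak{L}(x)=(x,0)\in\mathbb{R}^{p_f}$, $\mathfrak{R}(y)=(y_1,\dots,y_{d_o})$, where each $\psi_\ell:\mathbb{R}^{p_f}\to\mathbb{R}^{p_f}$ has a tensor-train representation $\psi_\ell(x)=U_1^\ell(x_1)\cdots U^\ell_{p_f}(x_{p_f})$ with $U_i^\ell:\mathbb{R}\to\mathbb{R}^{r_{i-1}\times r_i}$ having entries in $\operatorname{span}\Phi$, $r_0=p_f$, $r_{p_f}=1$, all ranks $r_i\le p_f$, and whose total number of parameters $\sum_\ell\sum_ir^\ell_{i-1}\,m\,r^\ell_i$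 is at most $n$. *)

theory Defs
  imports
    "HOL-Library.FuncSet"
    "HOL-Analysis.Analysis"
    "Jordan_Normal_Form.Matrix"
begin

text \<open>
  Vectors of \<open>\<real>\<^sup>n\<close> are elements of \<^term>\<open>carrier_vec n\<close>, with coordinates indexed from 0.
  A function from a domain \<open>\<Omega> \<subseteq> \<real>\<^sup>d\<close> to \<open>\<real>\<^sup>o\<close> is an element of \<open>\<Omega> \<rightarrow>\<^sub>E carrier_vec o\<close>
  (undefined off \<open>\<Omega>\<close>), so that equality of functions is equality on \<open>\<Omega>\<close>.
\<close>

type_synonym vfun = "real vec \<Rightarrow> real vec"


section \<open>Normed spaces of functions\<close>

definition fzero :: "real vec set \<Rightarrow> nat \<Rightarrow> vfun" where
  "fzero \<Omega> dout = (\<lambda>x\<in>\<Omega>. 0\<^sub>v dout)"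

definition fadd :: "real vec set \<Rightarrow> vfun \<Rightarrow> vfun \<Rightarrow> vfun" where
  "fadd \<Omega> f g = (\<lambda>x\<in>\<Omega>. f x + g x)"

definition fdiff :: "real vec set \<Rightarrow> vfun \<Rightarrow> vfun \<Rightarrow> vfun" where
  "fdiff \<Omega> f g = (\<lambda>x\<in>\<Omega>. f x - g x)"

definition fscale :: "real vec set \<Rightarrow> real \<Rightarrow> vfun \<Rightarrow> vfun" where
  "fscale \<Omega> a f = (\<lambda>x\<in>\<Omega>. a \<cdot>\<^sub>v f x)"

text \<open>
  Functions at distance 0 are identified, as usual in \<open>L\<^sup>p\<close> and Sobolev spaces: the normed space
  is the quotient of \<open>X\<close> by the null functions. Hence \<open>nrm f = 0\<close> is not required to imply that
  \<open>f\<close> vanishes at every point; spaces in which it does are included.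
\<close>

definition normed_function_space ::
    "real vec set \<Rightarrow> nat \<Rightarrow> vfun set \<Rightarrow> (vfun \<Rightarrow> real) \<Rightarrow> bool" where
  "normed_function_space \<Omega> dout X nrm \<longleftrightarrow>
     X \<subseteq> (\<Omega> \<rightarrow>\<^sub>E carrier_vec dout) \<and>
     fzero \<Omega> dout \<in> X \<and>
     (\<forall>f\<in>X. \<forall>g\<in>X. fadd \<Omega> f g \<in> X) \<and>
     (\<forall>a. \<forall>f\<in>X. fscale \<Omega> a f \<in> X) \<and>
     (\<forall>f\<in>X. 0 \<le> nrm f) \<and>
     (\<forall>f\<in>X. \<forall>g\<in>X. nrm (fadd \<Omega> f g) \<le> nrm f + nrm g) \<and>
     (\<forall>a. \<forall>f\<in>X. nrm (fscale \<Omega> a f) = \<bar>a\<bar> * nrm f)"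


section \<open>Approximation classes\<close>

text \<open>
  The approximation tool of a family of sets \<open>S n\<close> (functions of complexity at most \<open>n\<close>).
  By convention \<open>\<Sigma>\<^sub>0 = {0}\<close> and tools are nested, so the zero function has complexity 0 and
  belongs to every \<open>\<Sigma>\<^sub>n\<close>. This matters only when \<open>n\<close> is too small for any (suitable)
  architecture to exist: without it the best approximation error would be the infimum of an empty
  set, i.e. infinite, and all approximation classes would be empty.
\<close>

definition approx_tool :: "real vec set \<Rightarrow> nat \<Rightarrow> (nat \<Rightarrow> vfun set) \<Rightarrow> nat \<Rightarrow> vfun set" where
  "approx_tool \<Omega> dout S n =
     (if n = 0 then {fzero \<Omega> dout} else insert (fzero \<Omega> dout) (S n))"

definition best_error ::
    "real vec set \<Rightarrow> vfun set \<Rightarrow> (vfun \<Rightarrow> real) \<Rightarrow> vfun \<Rightarrow> vfun set \<Rightarrow> ennreal" where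
  "best_error \<Omega> X nrm f S = (INF g\<in>S \<inter> X. ennreal (nrm (fdiff \<Omega> f g)))"

text \<open>Powers of extended nonnegative reals, for exponents \<open>a > 0\<close>.\<close>

definition ennreal_powr :: "ennreal \<Rightarrow> real \<Rightarrow> ennreal" where
  "ennreal_powr x a = (if x = \<infinity> then \<infinity> else ennreal (enn2real x powr a))"

text \<open>The index \<open>k\<close> below stands for \<open>n - 1\<close> with \<open>n \<ge> 1\<close>.\<close>

definition approx_norm ::
    "real vec set \<Rightarrow> vfun set \<Rightarrow> (vfun \<Rightarrow> real) \<Rightarrow> real \<Rightarrow> ennreal \<Rightarrow> (nat \<Rightarrow> vfun set)
      \<Rightarrow> vfun \<Rightarrow> ennreal" where
  "approx_norm \<Omega> X nrm \<alpha> q \<Sigma> f =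
     (if q = \<infinity>
      then (SUP k. ennreal (real (Suc k) powr \<alpha>) * best_error \<Omega> X nrm f (\<Sigma> k))
      else ennreal_powr
             (\<Sum>k. ennreal_powr
                     (ennreal (real (Suc k) powr \<alpha>) * best_error \<Omega> X nrm f (\<Sigma> k))
                     (enn2real q)
                   * ennreal (1 / real (Suc k)))
             (1 / enn2real q))"

definition approx_class ::
    "real vec set \<Rightarrow> vfun set \<Rightarrow> (vfun \<Rightarrow> real) \<Rightarrow> real \<Rightarrow> ennreal \<Rightarrow> (nat \<Rightarrow> vfun set)
      \<Rightarrow> vfun set" where
  "approx_class \<Omega> X nrm \<alpha> q \<Sigma> = {f \<in> X. approx_norm \<Omega> X nrm \<alpha> q \<Sigma> f < \<infinity>}"

definition continuously_embedded ::
    "vfun set \<Rightarrow> (vfun \<Rightarrow> ennreal) \<Rightarrow> vfun set \<Rightarrow> (vfun \<Rightarrow> ennreal) \<Rightarrow> bool" where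
  "continuously_embedded A nA B nB \<longleftrightarrow>
     A \<subseteq> B \<and> (\<exists>C::real. 0 \<le> C \<and> (\<forall>f\<in>A. nB f \<le> ennreal C * nA f))"


section \<open>Deep neural networks of fixed width\<close>

type_synonym affine = "real mat \<times> real vec"

fun affine_apply :: "affine \<Rightarrow> real vec \<Rightarrow> real vec" where
  "affine_apply (W, b) x = W *\<^sub>v x + b"

fun affine_params :: "affine \<Rightarrow> nat" where
  "affine_params (W, b) = dim_row W * dim_col W + dim_vec b"

definition affine_maps :: "nat \<Rightarrow> nat \<Rightarrow> affine set" where
  "affine_maps din dout = carrier_mat dout din \<times> carrier_vec dout"

text \<open>The list of affine maps is \<open>[T\<^sub>1, \<dots>, T\<^sub>L]\<close>; the activation is not applied after \<open>T\<^sub>L\<close>.\<close>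

fun dnn_realize :: "(real \<Rightarrow> real) \<Rightarrow> affine list \<Rightarrow> real vec \<Rightarrow> real vec" where
  "dnn_realize \<sigma> [] x = x"
| "dnn_realize \<sigma> [T] x = affine_apply T x"
| "dnn_realize \<sigma> (T # T' # Ts) x = dnn_realize \<sigma> (T' # Ts) (map_vec \<sigma> (affine_apply T x))"

definition dnn_arch :: "nat \<Rightarrow> nat \<Rightarrow> nat \<Rightarrow> affine list \<Rightarrow> bool" where
  "dnn_arch d p dout Ts \<longleftrightarrow>
     2 \<le> length Ts \<and>
     hd Ts \<in> affine_maps d p \<and>
     (\<forall>l. 1 \<le> l \<and> l < length Ts - 1 \<longrightarrow> Ts ! l \<in> affine_maps p p) \<and>
     last Ts \<in> affine_maps p dout"

definition dnn ::
    "(real \<Rightarrow> real) \<Rightarrow> real vec set \<Rightarrow> nat \<Rightarrow> nat \<Rightarrow> nat \<Rightarrow> nat \<Rightarrow> vfun set" where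
  "dnn \<sigma> \<Omega> d p dout n =
     {restrict (dnn_realize \<sigma> Ts) \<Omega> | Ts.
        dnn_arch d p dout Ts \<and> sum_list (map affine_params Ts) \<le> n}"


section \<open>Compositional tensor trains of fixed width\<close>

text \<open>Linear span of a finite set of functions under pointwise operations.\<close>

definition fun_span :: "(real \<Rightarrow> real) set \<Rightarrow> (real \<Rightarrow> real) set" where
  "fun_span \<Phi> = {\<lambda>t. \<Sum>\<phi>\<in>\<Phi>. a \<phi> * \<phi> t | a. True}"

text \<open>
  A tensor train consists of ranks \<open>r\<^sub>0, \<dots>, r\<^sub>p\<close> and cores; core \<open>i\<close> (for \<open>i < p\<close>) is the
  \<open>r\<^sub>i \<times> r\<^sub>i\<^sub>+\<^sub>1\<close> matrix-valued function of the coordinate with 0-based index \<open>i\<close>.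
\<close>

type_synonym tensor_train = "(nat \<Rightarrow> nat) \<times> (nat \<Rightarrow> real \<Rightarrow> real mat)"

fun is_tensor_train :: "(real \<Rightarrow> real) set \<Rightarrow> nat \<Rightarrow> tensor_train \<Rightarrow> bool" where
  "is_tensor_train \<Phi> p (r, U) \<longleftrightarrow>
     r 0 = p \<and> r p = 1 \<and> (\<forall>i\<le>p. 1 \<le> r i \<and> r i \<le> p) \<and>
     (\<forall>i<p. \<forall>t. U i t \<in> carrier_mat (r i) (r (Suc i))) \<and>
     (\<forall>i<p. \<forall>a < r i. \<forall>b < r (Suc i). (\<lambda>t. U i t $$ (a, b)) \<in> fun_span \<Phi>)"

text \<open>The product of the cores is a \<open>p \<times> 1\<close> matrix, i.e. a vector of \<open>\<real>\<^sup>p\<close>.\<close>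

fun tt_eval :: "nat \<Rightarrow> tensor_train \<Rightarrow> real vec \<Rightarrow> real vec" where
  "tt_eval p (r, U) x = col (foldl (*) (1\<^sub>m p) (map (\<lambda>i. U i (x $ i)) [0..<p])) 0"

fun tt_params :: "(real \<Rightarrow> real) set \<Rightarrow> nat \<Rightarrow> tensor_train \<Rightarrow> nat" where
  "tt_params \<Phi> p (r, U) = (\<Sum>i<p. r i * card \<Phi> * r (Suc i))"

definition lift_vec :: "nat \<Rightarrow> nat \<Rightarrow> real vec \<Rightarrow> real vec" where
  "lift_vec d p x = x @\<^sub>v 0\<^sub>v (p - d)"

text \<open>The list of tensor trains is \<open>[\<psi>\<^sub>1, \<dots>, \<psi>\<^sub>L]\<close>, and \<open>\<psi>\<^sub>1\<close> acts first.\<close>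

definition ctt_realize :: "nat \<Rightarrow> nat \<Rightarrow> nat \<Rightarrow> tensor_train list \<Rightarrow> real vec \<Rightarrow> real vec" where
  "ctt_realize d p dout \<psi>s x =
     vec_first (fold (\<lambda>\<psi> y. y + tt_eval p \<psi> y) \<psi>s (lift_vec d p x)) dout"

definition ctt ::
    "(real \<Rightarrow> real) set \<Rightarrow> real vec set \<Rightarrow> nat \<Rightarrow> nat \<Rightarrow> nat \<Rightarrow> nat \<Rightarrow> vfun set" where
  "ctt \<Phi> \<Omega> d p dout n =
     {restrict (ctt_realize d p dout \<psi>s) \<Omega> | \<psi>s.
        1 \<le> length \<psi>s \<and> (\<forall>\<psi>\<in>set \<psi>s. is_tensor_train \<Phi> p \<psi>) \<and>
        sum_list (map (tt_params \<Phi> p) \<psi>s) \<le> n}"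

end

theory Submission
  imports Defs
begin

text \<open>
  A map \<open>y \<mapsto> c + A g(y)\<close>, with \<open>g\<close> acting componentwise, is a tensor train of ranks at most \<open>p\<close>.
  With \<open>g = id\<close> and \<open>A = W - I\<close>, its residual block is \<open>y \<mapsto> W y + c\<close>; with \<open>g = \<sigma> - id\<close>,
  \<open>A = I\<close> and \<open>c = 0\<close>, it is the activation. A network of depth \<open>L\<close> thus becomes at most \<open>2 L\<close>
  blocks with at most \<open>p\<^sup>3 |\<Phi>|\<close> parameters each, and it has at least \<open>L\<close> parameters itself.

  For the embedding, the errors of the two tools satisfy \<open>E\<^sub>C(k) \<le> E\<^sub>D(k div c)\<close>, and each value
  of \<open>k div c\<close> is taken \<open>c\<close> times; this costs a factor \<open>c\<^sup>\<alpha>\<^sup>+\<^sup>1\<^sup>/\<^sup>q\<close> in the approximation norm.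
\<close>

section \<open>Spans of univariate functions and tensor trains of separable maps\<close>

lemma fun_spanI: "(\<And>t. f t = (\<Sum>\<phi>\<in>\<Phi>. a \<phi> * \<phi> t)) \<Longrightarrow> f \<in> fun_span \<Phi>"
  unfolding fun_span_def by blast

lemma fun_span_base:
  assumes "finite \<Phi>" "f \<in> \<Phi>"
  shows "f \<in> fun_span \<Phi>"
proof (rule fun_spanI)
  show "f t = (\<Sum>\<phi>\<in>\<Phi>. (if \<phi> = f then 1 else 0) * \<phi> t)" for t
    using assms by (simp add: if_distrib[of "\<lambda>u. u * _"] sum.delta cong: if_cong)
qed

lemma fun_span_lincomb:
  assumes "f \<in> fun_span \<Phi>" "g \<in> fun_span \<Phi>"
  shows "(\<lambda>t. u * f t + v * g t) \<in> fun_span \<Phi>"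
proof -
  obtain a b where "f = (\<lambda>t. \<Sum>\<phi>\<in>\<Phi>. a \<phi> * \<phi> t)" "g = (\<lambda>t. \<Sum>\<phi>\<in>\<Phi>. b \<phi> * \<phi> t)"
    using assms unfolding fun_span_def by blast
  then show ?thesis
    by (intro fun_spanI[where a = "\<lambda>\<phi>. u * a \<phi> + v * b \<phi>"])
       (simp add: sum_distrib_left sum.distrib algebra_simps)
qed

lemma fun_span_affine:
  assumes "finite \<Phi>" "(\<lambda>_. 1) \<in> \<Phi>" "g \<in> fun_span \<Phi>"
  shows "(\<lambda>t. u + v * g t) \<in> fun_span \<Phi>"
  using fun_span_lincomb[OF fun_span_base[OF assms(1,2)] assms(3), of u v] by simp

text \<open>
  The train of \<open>y \<mapsto> c + A g(y)\<close>, with \<open>g\<close> applied componentwise: the product of the cores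
  \<open>i, \<dots>, p - 1\<close> (for \<open>i \<ge> 1\<close>) is the column \<open>(1, 0, \<dots>, 0, g(y\<^sub>i), \<dots>, g(y\<^sub>p\<^sub>-\<^sub>1))\<close>, which has
  only \<open>p\<close> entries because entry 0 need not be stored any more.
\<close>

definition separable_train ::
    "nat \<Rightarrow> (real \<Rightarrow> real) \<Rightarrow> real mat \<Rightarrow> real vec \<Rightarrow> tensor_train" where
  "separable_train p g A c =
     ((\<lambda>i. if i < p then p else 1),
      (\<lambda>i t. mat p (if Suc i < p then p else 1) (\<lambda>(a, b).
         if i = 0 then (if b = 0 then c $ a + A $$ (a, 0) * g t else A $$ (a, b))
         else if b = 0 then (if a = 0 then 1 else if a = i then g t else 0)
         else (if a = b \<and> i < a then 1 else 0))))"

text \<open>Each core entry is a constant, \<open>g\<close> itself or, in column 0 of core 0, an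
  affine function of \<open>g\<close>; constants are available because 1 is in
  \<open>\<Phi>\<close>.\<close>

lemma is_tensor_train_separable_train:
  assumes "finite \<Phi>" "(\<lambda>_. 1) \<in> \<Phi>" "g \<in> fun_span \<Phi>" "1 \<le> p"
  shows "is_tensor_train \<Phi> p (separable_train p g A c)"
proof -
  note span = fun_span_affine[OF assms(1-3)]
  have const: "(\<lambda>_. u) \<in> fun_span \<Phi>" for u
    using span[of u 0] by simp
  have cases: "(\<lambda>t. if P then f t else h t) \<in> fun_span \<Phi>"
    if "f \<in> fun_span \<Phi>" "h \<in> fun_span \<Phi>" for P and f h :: "real \<Rightarrow> real"
    using that by (cases P) auto
  show ?thesis
    using assms(4) unfolding separable_train_def is_tensor_train.simps
    by (simp cong: conj_cong if_cong) (auto intro!: cases const span assms(3) simp del: if_split)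
qed

lemma tt_params_separable_train:
  "tt_params \<Phi> p (separable_train p g A c) \<le> p ^ 3 * card \<Phi>"
proof -
  have "tt_params \<Phi> p (separable_train p g A c) \<le> (\<Sum>i<p. p * card \<Phi> * p)"
    unfolding separable_train_def tt_params.simps by (intro sum_mono mult_mono) auto
  then show ?thesis by (simp add: power3_eq_cube algebra_simps)
qed

text \<open>The proof multiplies from the left: after \<open>n\<close> cores, column 0 has
  accumulated the terms with \<open>k < n\<close>, and the later columns of \<open>A\<close> wait
  for their coordinates. The full product has only column 0 left.\<close>

lemma tt_eval_separable_train:
  assumes "1 \<le> p"
  shows "tt_eval p (separable_train p g A c) y =
           vec p (\<lambda>a. c $ a + (\<Sum>k<p. A $$ (a, k) * g (y $ k)))"
proof -
  define U where "U = snd (separable_train p g A c)"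
  \<comment> \<open>Columns strictly between 0 and \<open>n\<close> vanish: their entries of
    \<open>A\<close> are already absorbed into column 0.\<close>
  define M where "M n = mat p (if n < p then p else 1) (\<lambda>(a, b).
      if b = 0 then c $ a + (\<Sum>k<n. A $$ (a, k) * g (y $ k))
      else if n \<le> b then A $$ (a, b) else 0)" for n
  have U0: "1\<^sub>m p * U 0 (y $ 0) = M 1"
  proof -
    have "U 0 (y $ 0) = M 1"
      by (rule eq_matI) (auto simp: U_def M_def separable_train_def)
    moreover have "M 1 \<in> carrier_mat p (if 1 < p then p else 1)"
      by (simp add: M_def)
    ultimately show ?thesis by (metis left_mult_one_mat)
  qed
  have core: "M n * U n (y $ n) = M (Suc n)" if n: "1 \<le> n" "n < p" for n
  proof (rule eq_matI)
    fix a b assume "a < dim_row (M (Suc n))" "b < dim_col (M (Suc n))"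
    then have a: "a < p" and b: "b < (if Suc n < p then p else 1)" by (auto simp: M_def)
    then have bp: "b < p" using assms by (auto split: if_splits)
    have "(M n * U n (y $ n)) $$ (a, b) = (\<Sum>k<p. M n $$ (a, k) * U n (y $ n) $$ (k, b))"
      using a b n by (simp add: M_def U_def separable_train_def scalar_prod_def lessThan_atLeast0)
    also have "\<dots> = M (Suc n) $$ (a, b)"
    \<comment> \<open>Column 0 of core \<open>n\<close> is supported on rows 0 and \<open>n\<close>,
      so it adds \<open>A $$ (a, n) * g (y $ n)\<close> to the old column 0. Any other column
      \<open>b\<close> is the unit vector at \<open>b\<close> if \<open>b > n\<close> and zero
      otherwise: later columns pass through and column \<open>n\<close> is cleared.\<close>
    proof (cases "b = 0")
      case True
      have "(\<Sum>k<p. M n $$ (a, k) * U n (y $ n) $$ (k, b)) =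
            (\<Sum>k\<in>{0, n}. M n $$ (a, k) * U n (y $ n) $$ (k, b))"
        using n True by (intro sum.mono_neutral_right) (auto simp: U_def separable_train_def)
      then show ?thesis
        using n True a by (auto simp: U_def separable_train_def M_def)
    next
      case False
      have "(\<Sum>k<p. M n $$ (a, k) * U n (y $ n) $$ (k, b)) =
            (\<Sum>k\<in>{b}. M n $$ (a, k) * U n (y $ n) $$ (k, b))"
        using n False bp b by (intro sum.mono_neutral_right) (auto simp: U_def separable_train_def)
      then show ?thesis
        using n False a b bp by (auto simp: U_def separable_train_def M_def)
    qed
    finally show "(M n * U n (y $ n)) $$ (a, b) = M (Suc n) $$ (a, b)" .
  qed (auto simp: M_def U_def separable_train_def)
  have prod: "foldl (*) (1\<^sub>m p) (map (\<lambda>i. U i (y $ i)) [0..<n]) = M n" if "1 \<le> n" "n \<le> p" for n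
    using that
  proof (induction n rule: dec_induct)
    case base
    then show ?case using U0 by simp
  next
    case (step n)
    then show ?case using core by simp
  qed
  have "tt_eval p (separable_train p g A c) y = col (M p) 0"
    using prod[of p] assms by (simp add: U_def separable_train_def)
  also have "\<dots> = vec p (\<lambda>a. c $ a + (\<Sum>k<p. A $$ (a, k) * g (y $ k)))"
    by (rule eq_vecI) (auto simp: M_def)
  finally show ?thesis .
qed

section \<open>From network layers to residual blocks\<close>

definition affine_train :: "nat \<Rightarrow> real mat \<Rightarrow> real vec \<Rightarrow> tensor_train" where
  "affine_train p W b = separable_train p (\<lambda>t. t) (W - 1\<^sub>m p) b"

definition activation_train :: "nat \<Rightarrow> (real \<Rightarrow> real) \<Rightarrow> tensor_train" where
  "activation_train p \<sigma> = separable_train p (\<lambda>t. \<sigma> t - t) (1\<^sub>m p) (0\<^sub>v p)"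

lemma residual_affine_train:
  assumes "1 \<le> p" "W \<in> carrier_mat p p" "b \<in> carrier_vec p" "y \<in> carrier_vec p"
  shows "y + tt_eval p (affine_train p W b) y = W *\<^sub>v y + b"
proof (rule eq_vecI)
  fix a assume "a < dim_vec (W *\<^sub>v y + b)"
  then have a: "a < p" using assms by auto
  \<comment> \<open>The subtracted identity contributes \<open>- y $ a\<close>, which cancels the
    residual term.\<close>
  have "(\<Sum>k<p. (if a = k then 1 else 0) * y $ k) = y $ a"
    using a by (simp add: if_distrib[of "\<lambda>u. u * _"] sum.delta cong: if_cong)
  then show "(y + tt_eval p (affine_train p W b) y) $ a = (W *\<^sub>v y + b) $ a"
    using assms a by (simp add: affine_train_def tt_eval_separable_train scalar_prod_def
        lessThan_atLeast0 left_diff_distrib sum_subtractf del: tt_eval.simps)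
qed (use assms in \<open>auto simp: affine_train_def tt_eval_separable_train simp del: tt_eval.simps\<close>)

lemma residual_activation_train:
  assumes "1 \<le> p" "y \<in> carrier_vec p"
  shows "y + tt_eval p (activation_train p \<sigma>) y = map_vec \<sigma> y"
proof (rule eq_vecI)
  fix a assume "a < dim_vec (map_vec \<sigma> y)"
  then have a: "a < p" using assms by auto
  have "(\<Sum>k<p. (if a = k then 1 else 0) * (\<sigma> (y $ k) - y $ k)) = \<sigma> (y $ a) - y $ a"
    using a by (simp add: if_distrib[of "\<lambda>u. u * _"] sum.delta cong: if_cong)
  then show "(y + tt_eval p (activation_train p \<sigma>) y) $ a = map_vec \<sigma> y $ a"
    using assms a by (simp add: activation_train_def tt_eval_separable_train del: tt_eval.simps)
qed (use assms in \<open>auto simp: activation_train_def tt_eval_separable_train simp del: tt_eval.simps\<close>)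

text \<open>For the output layer: zero rows raise its output dimension to \<open>p\<close>, and the
  final truncation removes them.\<close>

lemma affine_pad_rows:
  assumes "(W, b) \<in> affine_maps p dout" "dout \<le> p"
  obtains W' b' where "W' \<in> carrier_mat p p" "b' \<in> carrier_vec p"
    "\<And>y. y \<in> carrier_vec p \<Longrightarrow> vec_first (W' *\<^sub>v y + b') dout = W *\<^sub>v y + b"
proof
  define W' where "W' = mat p p (\<lambda>(i, j). if i < dout then W $$ (i, j) else 0)"
  define b' where "b' = vec p (\<lambda>i. if i < dout then b $ i else 0)"
  show "W' \<in> carrier_mat p p" "b' \<in> carrier_vec p" by (auto simp: W'_def b'_def)
  show "vec_first (W' *\<^sub>v y + b') dout = W *\<^sub>v y + b" if "y \<in> carrier_vec p" for y
    using assms that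
    by (intro eq_vecI)
       (auto simp: affine_maps_def W'_def b'_def vec_first_def scalar_prod_def intro!: sum.cong)
qed

text \<open>For the input layer: zero columns are appended, and they meet only the zeros that
  \<open>lift_vec\<close> appends to \<open>x\<close>.\<close>

lemma affine_pad_cols:
  assumes "(W, b) \<in> affine_maps d p" "d \<le> p"
  obtains W' where "(W', b) \<in> affine_maps p p"
    "\<And>x. x \<in> carrier_vec d \<Longrightarrow> W' *\<^sub>v lift_vec d p x + b = W *\<^sub>v x + b"
proof
  define W' where "W' = mat p p (\<lambda>(i, j). if j < d then W $$ (i, j) else 0)"
  show "(W', b) \<in> affine_maps p p" using assms by (auto simp: W'_def affine_maps_def)
  show "W' *\<^sub>v lift_vec d p x + b = W *\<^sub>v x + b" if x: "x \<in> carrier_vec d" for x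
  proof (rule eq_vecI)
    fix i assume "i < dim_vec (W *\<^sub>v x + b)"
    then have i: "i < p" using assms by (auto simp: affine_maps_def)
    have "(\<Sum>j<p. W' $$ (i, j) * lift_vec d p x $ j) =
          (\<Sum>j<d. W' $$ (i, j) * lift_vec d p x $ j)"
      using assms i by (intro sum.mono_neutral_right) (auto simp: W'_def)
    also have "\<dots> = (\<Sum>j<d. W $$ (i, j) * x $ j)"
      using assms i x by (intro sum.cong) (auto simp: W'_def lift_vec_def)
    finally have eq: "(\<Sum>j<p. W' $$ (i, j) * lift_vec d p x $ j) = (\<Sum>j<d. W $$ (i, j) * x $ j)" .
    have dims: "dim_vec (lift_vec d p x) = p" "dim_row W' = p" "dim_col W' = p"
      "dim_row W = p" "dim_col W = d" "dim_vec b = p" "dim_vec x = d"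
      using assms x by (auto simp: lift_vec_def W'_def affine_maps_def)
    show "(W' *\<^sub>v lift_vec d p x + b) $ i = (W *\<^sub>v x + b) $ i"
      using eq i dims by (simp add: scalar_prod_def lessThan_atLeast0)
  qed (use assms in \<open>auto simp: affine_maps_def W'_def\<close>)
qed

text \<open>All maps start from dimension \<open>p\<close> here and, unlike in
  \<open>dnn_arch\<close>, a single map is allowed. Hence the statement applies to every nonempty
  tail of the list, as the induction requires.\<close>

lemma ctt_blocks_of_dnn:
  assumes "1 \<le> p" "dout \<le> p"
    and "finite \<Phi>" "(\<lambda>_. 1) \<in> \<Phi>" "(\<lambda>t. t) \<in> \<Phi>" "\<sigma> \<in> fun_span \<Phi>"
    and "Ts \<noteq> []" "set (butlast Ts) \<subseteq> affine_maps p p" "last Ts \<in> affine_maps p dout"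
  shows "\<exists>\<psi>s. 1 \<le> length \<psi>s \<and> length \<psi>s \<le> 2 * length Ts \<and>
    (\<forall>\<psi>\<in>set \<psi>s. is_tensor_train \<Phi> p \<psi> \<and> tt_params \<Phi> p \<psi> \<le> p ^ 3 * card \<Phi>) \<and>
    (\<forall>y\<in>carrier_vec p.
       vec_first (fold (\<lambda>\<psi> y. y + tt_eval p \<psi> y) \<psi>s y) dout = dnn_realize \<sigma> Ts y)"
  using assms(7-)
\<comment> \<open>The cases follow the equations of \<open>dnn_realize\<close>: the last map yields
  one block, since no activation follows it, and every earlier map yields two.\<close>
proof (induction Ts rule: induct_list012)
  case 1
  then show ?case by simp
next
  have id: "(\<lambda>t. t) \<in> fun_span \<Phi>" using fun_span_base[OF assms(3,5)] .
  then have act: "(\<lambda>t. \<sigma> t - t) \<in> fun_span \<Phi>"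
    using fun_span_lincomb[OF assms(6) id, of 1 "-1"] by simp
  note good = is_tensor_train_separable_train[OF assms(3,4) _ assms(1)] tt_params_separable_train
  have affine: "is_tensor_train \<Phi> p (affine_train p W b)"
    "tt_params \<Phi> p (affine_train p W b) \<le> p ^ 3 * card \<Phi>" for W b
    unfolding affine_train_def by (intro good id)+
  have activation: "is_tensor_train \<Phi> p (activation_train p \<sigma>)"
    "tt_params \<Phi> p (activation_train p \<sigma>) \<le> p ^ 3 * card \<Phi>"
    unfolding activation_train_def by (intro good act)+
  {
    case (2 T)
    obtain W b where T: "T = (W, b)" by (cases T)
    then have "(W, b) \<in> affine_maps p dout" using 2(3) by simp
    then obtain W' b' where W': "W' \<in> carrier_mat p p" "b' \<in> carrier_vec p"
      "\<And>y. y \<in> carrier_vec p \<Longrightarrow> vec_first (W' *\<^sub>v y + b') dout = W *\<^sub>v y + b"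
      using affine_pad_rows[OF _ assms(2)] by blast
    then show ?case
      using affine residual_affine_train[OF assms(1) W'(1,2)]
      by (intro exI[of _ "[affine_train p W' b']"]) (simp add: T)
  next
    case (3 T T' Ts)
    obtain W b where T: "T = (W, b)" by (cases T)
    then have Wb: "W \<in> carrier_mat p p" "b \<in> carrier_vec p"
      using 3(4) by (auto simp: affine_maps_def)
    have "set (butlast (T' # Ts)) \<subseteq> affine_maps p p" "last (T' # Ts) \<in> affine_maps p dout"
      using 3(4,5) by auto
    from 3(2)[OF list.distinct(2) this] obtain \<psi>s where
      \<psi>s: "1 \<le> length \<psi>s" "length \<psi>s \<le> 2 * length (T' # Ts)"
      "\<forall>\<psi>\<in>set \<psi>s. is_tensor_train \<Phi> p \<psi> \<and> tt_params \<Phi> p \<psi> \<le> p ^ 3 * card \<Phi>"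
      and eval: "\<forall>y\<in>carrier_vec p.
        vec_first (fold (\<lambda>\<psi> y. y + tt_eval p \<psi> y) \<psi>s y) dout = dnn_realize \<sigma> (T' # Ts) y"
      by blast
    have layer: "W *\<^sub>v y + b \<in> carrier_vec p" for y
      by (rule carrier_vecI) (use Wb in simp)
    have "vec_first (fold (\<lambda>\<psi> y. y + tt_eval p \<psi> y)
        (affine_train p W b # activation_train p \<sigma> # \<psi>s) y) dout = dnn_realize \<sigma> (T # T' # Ts) y"
      if "y \<in> carrier_vec p" for y
    proof -
      have "map_vec \<sigma> (W *\<^sub>v y + b) \<in> carrier_vec p" using layer by simp
      with eval show ?thesis
        by (simp only: T fold_simps affine_apply.simps dnn_realize.simps
            residual_affine_train[OF assms(1) Wb that]
            residual_activation_train[OF assms(1) layer])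
    qed
    then show ?case
      using \<psi>s affine activation
      by (intro exI[of _ "affine_train p W b # activation_train p \<sigma> # \<psi>s"]) auto
  }
qed

lemma dnn_subset_ctt:
  assumes "1 \<le> dout" "d \<le> p" "dout \<le> p"
    and "finite \<Phi>" "(\<lambda>_. 1) \<in> \<Phi>" "(\<lambda>t. t) \<in> \<Phi>" "\<sigma> \<in> fun_span \<Phi>"
    and "\<Omega> \<subseteq> carrier_vec d"
  shows "dnn \<sigma> \<Omega> d p dout n \<subseteq> ctt \<Phi> \<Omega> d p dout (2 * (p ^ 3 * card \<Phi>) * n)"
proof
  have p: "1 \<le> p" using assms by simp
  fix f assume "f \<in> dnn \<sigma> \<Omega> d p dout n"
  then obtain Ts where f: "f = restrict (dnn_realize \<sigma> Ts) \<Omega>" and arch: "dnn_arch d p dout Ts"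
    and n: "sum_list (map affine_params Ts) \<le> n"
    unfolding dnn_def by blast
  have "2 \<le> length Ts" using arch by (simp add: dnn_arch_def)
  then obtain T T' Ts' where Ts: "Ts = T # T' # Ts'"
    by (metis Suc_le_length_iff numeral_2_eq_2)
  have last: "last (T' # Ts') \<in> affine_maps p dout"
    using arch by (simp add: dnn_arch_def Ts)
  \<comment> \<open>Position \<open>i\<close> of the tail is position \<open>i + 1\<close> of
    \<open>Ts\<close>; without its last map, the tail covers exactly the hidden positions of
    \<open>dnn_arch\<close>.\<close>
  have hidden: "set (butlast (T' # Ts')) \<subseteq> affine_maps p p"
  proof
    fix S assume "S \<in> set (butlast (T' # Ts'))"
    then obtain i where i: "i < length Ts'" "S = butlast (T' # Ts') ! i"
      by (metis in_set_conv_nth length_butlast length_Cons diff_Suc_1)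
    then have "S = Ts ! Suc i" by (simp add: Ts nth_butlast del: butlast.simps)
    moreover have "Suc i < length Ts - 1" using i(1) by (simp add: Ts)
    ultimately show "S \<in> affine_maps p p" using arch by (simp add: dnn_arch_def)
  qed
  have "T \<in> affine_maps d p" using arch by (simp add: dnn_arch_def Ts)
  then obtain W b where T: "T = (W, b)" and Wb: "(W, b) \<in> affine_maps d p" by (cases T) auto
  from affine_pad_cols[OF Wb assms(2)] obtain W' where W': "(W', b) \<in> affine_maps p p"
    "\<And>x. x \<in> carrier_vec d \<Longrightarrow> W' *\<^sub>v lift_vec d p x + b = W *\<^sub>v x + b"
    by blast
  \<comment> \<open>Only the input map is replaced: the others already start from dimension
    \<open>p\<close>, and the depth is unchanged.\<close>
  define Ts0 where "Ts0 = (W', b) # T' # Ts'"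
  have "Ts0 \<noteq> []" "set (butlast Ts0) \<subseteq> affine_maps p p" "last Ts0 \<in> affine_maps p dout"
    using hidden last W'(1) by (auto simp: Ts0_def)
  from ctt_blocks_of_dnn[OF p assms(3-7) this] obtain \<psi>s where
    \<psi>s: "1 \<le> length \<psi>s" "length \<psi>s \<le> 2 * length Ts0"
      "\<forall>\<psi>\<in>set \<psi>s. is_tensor_train \<Phi> p \<psi> \<and> tt_params \<Phi> p \<psi> \<le> p ^ 3 * card \<Phi>"
    and eval: "\<And>y. y \<in> carrier_vec p \<Longrightarrow>
       vec_first (fold (\<lambda>\<psi> y. y + tt_eval p \<psi> y) \<psi>s y) dout = dnn_realize \<sigma> Ts0 y"
    by blast
  have "ctt_realize d p dout \<psi>s x = dnn_realize \<sigma> Ts x" if "x \<in> \<Omega>" for x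
  proof -
    have x: "x \<in> carrier_vec d" using that assms(8) by blast
    then have "lift_vec d p x \<in> carrier_vec p"
      using assms(2) by (intro carrier_vecI) (simp add: lift_vec_def)
    then show ?thesis
      using eval W'(2)[OF x] by (simp add: ctt_realize_def Ts0_def Ts T)
  qed
  then have f': "f = restrict (ctt_realize d p dout \<psi>s) \<Omega>"
    unfolding f by (intro restrict_ext) simp
  \<comment> \<open>The bias of each layer has length \<open>p\<close> or \<open>dout\<close>, both
    positive. This is what bounds the depth by the number of parameters.\<close>
  have pos: "1 \<le> affine_params S" if "S \<in> set Ts" for S
  proof -
    have "set (T' # Ts') = set (butlast (T' # Ts') @ [last (T' # Ts')])"
      by (simp only: append_butlast_last_id list.distinct not_False_eq_True)
    then have "S \<in> insert T (set (butlast (T' # Ts')) \<union> {last (T' # Ts')})"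
      using that by (simp only: Ts list.set set_append)
    then have "S \<in> affine_maps d p \<union> affine_maps p p \<union> affine_maps p dout"
      using hidden last \<open>T \<in> affine_maps d p\<close> by blast
    then show ?thesis using p assms(1) by (cases S) (auto simp: affine_maps_def)
  qed
  have "length Ts \<le> sum_list (map affine_params Ts)"
    using sum_list_mono[of Ts "\<lambda>_. 1" affine_params] pos by (simp add: sum_list_triv)
  then have len: "length \<psi>s \<le> 2 * n" using n \<psi>s(2) by (simp add: Ts0_def Ts)
  have "sum_list (map (tt_params \<Phi> p) \<psi>s) \<le> length \<psi>s * (p ^ 3 * card \<Phi>)"
    using sum_list_mono[of \<psi>s "tt_params \<Phi> p" "\<lambda>_. p ^ 3 * card \<Phi>"] \<psi>s(3)
    by (simp add: sum_list_triv)
  also have "\<dots> \<le> 2 * n * (p ^ 3 * card \<Phi>)" using len by (rule mult_le_mono1)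
  finally have "sum_list (map (tt_params \<Phi> p) \<psi>s) \<le> 2 * (p ^ 3 * card \<Phi>) * n"
    by (simp add: algebra_simps)
  then show "f \<in> ctt \<Phi> \<Omega> d p dout (2 * (p ^ 3 * card \<Phi>) * n)"
    unfolding ctt_def f' using \<psi>s by blast
qed

section \<open>Comparison of approximation norms\<close>

lemma ennreal_powr_mono: "x \<le> y \<Longrightarrow> 0 \<le> a \<Longrightarrow> ennreal_powr x a \<le> ennreal_powr y a"
  by (auto simp: ennreal_powr_def top_unique less_top intro!: ennreal_leI powr_mono2 enn2real_mono)

lemma ennreal_powr_cmult:
  assumes "0 < c"
  shows "ennreal_powr (ennreal c * x) a = ennreal (c powr a) * ennreal_powr x a"
proof (cases "x = \<infinity>")
  case True
  then show ?thesis using assms by (simp add: ennreal_powr_def ennreal_mult_top)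
next
  case False
  then show ?thesis
    using assms by (auto simp: ennreal_powr_def ennreal_mult_eq_top_iff enn2real_mult powr_mult ennreal_mult)
qed

text \<open>The indices \<open>k\<close> with \<open>k div c = m\<close> form a block of
  \<open>c\<close> consecutive numbers, so each \<open>a m\<close> is counted \<open>c\<close>
  times.\<close>

lemma suminf_div_le:
  fixes a :: "nat \<Rightarrow> ennreal"
  assumes "0 < c"
  shows "(\<Sum>k. a (k div c)) \<le> of_nat c * (\<Sum>j. a j)"
proof (rule suminf_le_const)
  fix n
  have block: "(\<Sum>k = m * c..<m * c + c. a (k div c)) = of_nat c * a m" for m
  proof -
    have "(\<Sum>k = m * c..<m * c + c. a (k div c)) = (\<Sum>k = m * c..<m * c + c. a m)"
    proof (intro sum.cong refl)
      fix k assume "k \<in> {m * c..<m * c + c}"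
      then have "k div c = m" by (intro div_nat_eqI) (auto simp: mult.commute)
      then show "a (k div c) = a m" by simp
    qed
    then show ?thesis by simp
  qed
  \<comment> \<open>The range is enlarged to whole blocks, which can only increase a sum of
    nonnegative terms.\<close>
  have "(\<Sum>k<n. a (k div c)) \<le> (\<Sum>k<n * c. a (k div c))"
    using assms by (intro sum_mono2) auto
  also have "\<dots> = of_nat c * (\<Sum>m<n. a m)"
    unfolding sum.nat_group[symmetric] block by (simp add: sum_distrib_left)
  also have "\<dots> \<le> of_nat c * (\<Sum>j. a j)"
    by (intro mult_left_mono sum_le_suminf) auto
  finally show "(\<Sum>k<n. a (k div c)) \<le> of_nat c * (\<Sum>j. a j)" .
qed simp

lemma best_error_antimono: "S \<subseteq> T \<Longrightarrow> best_error \<Omega> X nrm f T \<le> best_error \<Omega> X nrm f S"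
  unfolding best_error_def by (intro INF_superset_mono) auto

text \<open>The inclusions \<open>S (k div c) \<subseteq> T (c * (k div c)) \<subseteq> T k\<close>
  bound the error at \<open>k\<close> by the one at \<open>k div c\<close>, uniformly in
  \<open>f\<close>.\<close>

lemma approx_norm_le:
  fixes S T :: "nat \<Rightarrow> vfun set"
  assumes c: "1 \<le> c" and sub: "\<And>n. S n \<subseteq> T (c * n)" and mono: "mono T"
    and "0 < \<alpha>" and "0 < q"
  shows "\<exists>C\<ge>0. \<forall>f. approx_norm \<Omega> X nrm \<alpha> q T f \<le> ennreal C * approx_norm \<Omega> X nrm \<alpha> q S f"
proof -
  let ?w = "\<lambda>k. ennreal (real (Suc k) powr \<alpha>)"
  have c0: "0 < c" "0 < real c" using c by auto
  have le: "?w k * best_error \<Omega> X nrm f (T k) \<le>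
      ennreal (real c powr \<alpha>) * (?w (k div c) * best_error \<Omega> X nrm f (S (k div c)))" for f k
  proof -
    have "S (k div c) \<subseteq> T k" using sub[of "k div c"] monoD[OF mono, of "c * (k div c)" k] by auto
    then have e: "best_error \<Omega> X nrm f (T k) \<le> best_error \<Omega> X nrm f (S (k div c))"
      by (rule best_error_antimono)
    \<comment> \<open>The weight at index \<open>k\<close> is a power of \<open>k + 1\<close>, so
      the rounding is compared after the shift; this costs the factor
      \<open>c powr \<alpha>\<close>.\<close>
    have "k < c * Suc (k div c)" using dividend_less_times_div[OF c0(1), of k] by simp
    then have "Suc k \<le> c * Suc (k div c)" by simp
    then have "real (Suc k) \<le> real c * real (Suc (k div c))"
      by (metis of_nat_mono of_nat_mult)
    then have "real (Suc k) powr \<alpha> \<le> (real c * real (Suc (k div c))) powr \<alpha>"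
      using assms(4) by (intro powr_mono2) auto
    then have "?w k \<le> ennreal (real c powr \<alpha>) * ?w (k div c)"
      by (simp add: powr_mult ennreal_mult[symmetric] ennreal_leI)
    then show ?thesis unfolding mult.assoc[symmetric] by (rule mult_mono[OF _ e]) auto
  qed
  show ?thesis
  proof (cases "q = \<infinity>")
    case True
    have "approx_norm \<Omega> X nrm \<alpha> q T f \<le> ennreal (real c powr \<alpha>) * approx_norm \<Omega> X nrm \<alpha> q S f" for f
      unfolding approx_norm_def if_P[OF True]
    proof (rule SUP_least)
      fix k
      show "?w k * best_error \<Omega> X nrm f (T k) \<le>
          ennreal (real c powr \<alpha>) * (SUP k. ?w k * best_error \<Omega> X nrm f (S k))"
        by (rule order_trans[OF le]) (intro mult_left_mono SUP_upper, auto)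
    qed
    then show ?thesis by (intro exI[of _ "real c powr \<alpha>"]) simp
  next
    case False
    define r where "r = enn2real q"
    have r: "0 < r" using False assms(5) by (simp add: r_def enn2real_positive_iff less_top)
    \<comment> \<open>The first factor comes from the weights, the second from
      \<open>suminf_div_le\<close>; the \<open>r\<close>-th root of \<open>K\<close> is
      \<open>c powr (\<alpha> + 1 / r)\<close>.\<close>
    define K where "K = (real c powr \<alpha>) powr r * real c"
    have K: "0 < K" using c0 by (simp add: K_def)
    have "approx_norm \<Omega> X nrm \<alpha> q T f \<le> ennreal (K powr (1 / r)) * approx_norm \<Omega> X nrm \<alpha> q S f" for f
    proof -
      define a where "a k = ennreal_powr (?w k * best_error \<Omega> X nrm f (S k)) r
                      * ennreal (1 / real (Suc k))" for k
      have "ennreal_powr (?w k * best_error \<Omega> X nrm f (T k)) r * ennreal (1 / real (Suc k))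
              \<le> ennreal ((real c powr \<alpha>) powr r) * a (k div c)" for k
      proof -
        have "ennreal_powr (?w k * best_error \<Omega> X nrm f (T k)) r \<le>
            ennreal ((real c powr \<alpha>) powr r) *
            ennreal_powr (?w (k div c) * best_error \<Omega> X nrm f (S (k div c))) r"
          using ennreal_powr_mono[OF le, of r] r c0 by (simp add: ennreal_powr_cmult)
        \<comment> \<open>Moving the harmonic weight from \<open>k\<close> to \<open>k div c\<close>
          costs no constant, since it decreases in the index.\<close>
        moreover have "ennreal (1 / real (Suc k)) \<le> ennreal (1 / real (Suc (k div c)))"
          by (intro ennreal_leI divide_left_mono) (auto intro: div_le_dividend)
        ultimately show ?thesis
          unfolding a_def mult.assoc[symmetric] by (intro mult_mono) auto
      qed
      then have "(\<Sum>k. ennreal_powr (?w k * best_error \<Omega> X nrm f (T k)) r * ennreal (1 / real (Suc k)))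
          \<le> (\<Sum>k. ennreal ((real c powr \<alpha>) powr r) * a (k div c))"
        by (intro suminf_le) auto
      also have "\<dots> = ennreal ((real c powr \<alpha>) powr r) * (\<Sum>k. a (k div c))" by simp
      also have "\<dots> \<le> ennreal ((real c powr \<alpha>) powr r) * (of_nat c * (\<Sum>j. a j))"
        by (intro mult_left_mono suminf_div_le c0) auto
      also have "\<dots> = ennreal K * (\<Sum>j. a j)"
        by (simp add: K_def ennreal_mult ennreal_of_nat_eq_real_of_nat mult.assoc)
      finally have "ennreal_powr (\<Sum>k. ennreal_powr (?w k * best_error \<Omega> X nrm f (T k)) r
            * ennreal (1 / real (Suc k))) (1 / r)
          \<le> ennreal_powr (ennreal K * (\<Sum>j. a j)) (1 / r)"
        using r by (intro ennreal_powr_mono) auto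
      then show ?thesis
        using False K by (simp add: approx_norm_def a_def r_def[symmetric] ennreal_powr_cmult)
    qed
    then show ?thesis by (intro exI[of _ "K powr (1 / r)"]) simp
  qed
qed

text \<open>The constant is a real number, so the norm estimate also carries finiteness over and
  yields the inclusion of the classes.\<close>

lemma continuously_embedded_approx_class:
  fixes S T :: "nat \<Rightarrow> vfun set"
  assumes "1 \<le> c" "\<And>n. S n \<subseteq> T (c * n)" "mono T" "0 < \<alpha>" "0 < q"
  shows "continuously_embedded
      (approx_class \<Omega> X nrm \<alpha> q S) (approx_norm \<Omega> X nrm \<alpha> q S)
      (approx_class \<Omega> X nrm \<alpha> q T) (approx_norm \<Omega> X nrm \<alpha> q T)"
proof -
  obtain C where C: "0 \<le> C"
    "\<And>f. approx_norm \<Omega> X nrm \<alpha> q T f \<le> ennreal C * approx_norm \<Omega> X nrm \<alpha> q S f"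
    using approx_norm_le[where S = S and T = T, OF assms] by blast
  have "approx_norm \<Omega> X nrm \<alpha> q T f < \<infinity>" if "approx_norm \<Omega> X nrm \<alpha> q S f < \<infinity>" for f
    using le_less_trans[OF C(2)] that by (simp add: ennreal_mult_less_top)
  then show ?thesis
    unfolding continuously_embedded_def approx_class_def using C by auto
qed

lemma mono_approx_tool: "mono S \<Longrightarrow> mono (approx_tool \<Omega> dout S)"
  unfolding mono_def approx_tool_def by auto

lemma mono_ctt: "mono (ctt \<Phi> \<Omega> d p dout)"
  unfolding mono_def ctt_def by fastforce

theorem mainTheorem7:
  fixes d dout p :: nat
    and \<sigma> :: "real \<Rightarrow> real"
    and \<Phi> :: "(real \<Rightarrow> real) set"
    and \<Omega> :: "real vec set"
    and X :: "(real vec \<Rightarrow> real vec) set"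
    and nrm :: "(real vec \<Rightarrow> real vec) \<Rightarrow> real"
    and \<alpha> :: real
    and q :: ennreal
  assumes "1 \<le> d" and "1 \<le> dout" and "d \<le> p" and "dout \<le> p"
    and "finite \<Phi>" and "(\<lambda>_. 1) \<in> \<Phi>" and "(\<lambda>t. t) \<in> \<Phi>" and "\<sigma> \<in> fun_span \<Phi>"
    and "\<Omega> \<subseteq> carrier_vec d"
    and "normed_function_space \<Omega> dout X nrm"
    and "0 < \<alpha>" and "0 < q"
  shows "(\<exists>c::nat. 1 \<le> c \<and> (\<forall>n. dnn \<sigma> \<Omega> d p dout n \<subseteq> ctt \<Phi> \<Omega> d p dout (c * n))) \<and>
    continuously_embedded
      (approx_class \<Omega> X nrm \<alpha> q (approx_tool \<Omega> dout (dnn \<sigma> \<Omega> d p dout)))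
      (approx_norm \<Omega> X nrm \<alpha> q (approx_tool \<Omega> dout (dnn \<sigma> \<Omega> d p dout)))
      (approx_class \<Omega> X nrm \<alpha> q (approx_tool \<Omega> dout (ctt \<Phi> \<Omega> d p dout)))
      (approx_norm \<Omega> X nrm \<alpha> q (approx_tool \<Omega> dout (ctt \<Phi> \<Omega> d p dout)))"
proof -
  \<comment> \<open>At most two blocks per layer, each with at most
    \<open>p ^ 3 * card \<Phi>\<close> parameters.\<close>
  define c where "c = 2 * (p ^ 3 * card \<Phi>)"
  have "card \<Phi> \<noteq> 0" using assms(5,6) by auto
  then have c: "1 \<le> c" using assms(1,3) by (simp add: c_def Suc_le_eq)
  have sub: "dnn \<sigma> \<Omega> d p dout n \<subseteq> ctt \<Phi> \<Omega> d p dout (c * n)" for n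
    unfolding c_def using assms(2-9) by (rule dnn_subset_ctt)
  \<comment> \<open>As \<open>c\<close> is positive, \<open>c * n = 0\<close> only for
    \<open>n = 0\<close>, so the convention at index 0 applies to both tools simultaneously.\<close>
  then have "approx_tool \<Omega> dout (dnn \<sigma> \<Omega> d p dout) n \<subseteq>
      approx_tool \<Omega> dout (ctt \<Phi> \<Omega> d p dout) (c * n)" for n
    using c by (auto simp: approx_tool_def)
  from continuously_embedded_approx_class[OF c this mono_approx_tool[OF mono_ctt] assms(11,12)]
  show ?thesis using c sub by blast
qed

end
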